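(* Let $\Delta$ be an operation that associates with every integer $n\geq 0$ and every simplicial complex $\Gamma$ on the vertex set $[n]=\{1,\ldots,n\}$ a shifted simplicial complex $\Delta(\Gamma)$ on the same vertex set $[n]$. Assume that $\Delta$ satisfies the following properties, for all $n$ and all complexes on $[n]$: (1) $f(\Delta(\Gamma))=f(\Gamma)$; (2) $\Delta(\Gamma\ast\{n+1\})=\Delta(\Gamma)\ast\{n+1\}$; (3) if $\Gamma'\subseteq\Gamma$, then $\Delta(\Gamma')\subseteq\Delta(\Gamma)$; (4) $\sum_{i=0}^{\dim\Gamma}\beta_i(\Gamma)\leq\sum_{i=0}^{\dim\Delta(\Gamma)}\beta_i(\Delta(\Gamma))$. Then for every shifted complex $\Gamma$, $\Delta(\Gamma)=\Gamma$.
   Context: A simplicial complex on the vertex set $[n]$ is a collection $\Gamma$ of subsets of $[n]$ closed under taking subsets (it is not required that every singleton $\{i\}$ be in $\Gamma$). Elements are faces; $\dim F=|F|-1$; $\dim\Gamma$ is the maximal face dimension. The $f$-vector is $f(\Gamma)=(f_{-1},f_0,\ldots,f_{\dim\Gamma})$ where $f_i$ is the number of faces of dimension $i$. $\beta_i(\Gamma)=\dim_{\mathbf k}\widetilde H_i(\Gamma;\mathbf k)$ are the reduced simplicial Betti numbers over a fixed field $\mathbf k$. $\Gamma$ is shifted if for every $F\in\Gamma$, $i\in F$ and $i<j\leq n$, the set $(F\setminus\{i\})\cup\{j\}$ is in $\Gamma$. The cone $\Gamma\ast\{n+1\}$ is the complex on $[n+1]$ whose faces are the faces of $\Gamma$ together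 with $\{F\cup\{n+1\}: F\in\Gamma\}$. *)

theory Defs
  imports "HOL-Algebra.AbelCoset" "HOL-Algebra.Module" "Jordan_Normal_Form.VS_Connect"
begin

section \<open>Simplicial complexes on the vertex set $[n]$\<close>

definition simplicial_complex :: "nat \<Rightarrow> nat set set \<Rightarrow> bool" where
  "simplicial_complex n \<Gamma> \<longleftrightarrow> \<Gamma> \<subseteq> Pow {1..n} \<and> (\<forall>F\<in>\<Gamma>. \<forall>G. G \<subseteq> F \<longrightarrow> G \<in> \<Gamma>)"

definition face_dim :: "nat set \<Rightarrow> int" where
  "face_dim F = int (card F) - 1"

text \<open>The void complex, which has no faces at all (not even the empty one), is a legitimate
  complex. It gets dimension \<open>-2\<close>, below the dimension \<open>-1\<close> of the complex whose only face is the
  empty set, so that its \<open>f\<close>-vector is the empty list.\<close>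

definition complex_dim :: "nat set set \<Rightarrow> int" where
  "complex_dim \<Gamma> = (if \<Gamma> = {} then -2 else Max (face_dim ` \<Gamma>))"

definition faces :: "int \<Rightarrow> nat set set \<Rightarrow> nat set set" where
  "faces i \<Gamma> = {F \<in> \<Gamma>. face_dim F = i}"

definition f_vector :: "nat set set \<Rightarrow> nat list" where
  "f_vector \<Gamma> = map (\<lambda>i. card (faces i \<Gamma>)) [-1..complex_dim \<Gamma>]"

definition shifted :: "nat \<Rightarrow> nat set set \<Rightarrow> bool" where
  "shifted n \<Gamma> \<longleftrightarrow>
    (\<forall>F\<in>\<Gamma>. \<forall>i\<in>F. \<forall>j. i < j \<and> j \<le> n \<longrightarrow> (F - {i}) \<union> {j} \<in> \<Gamma>)"

text \<open>The cone with apex \<open>n + 1\<close> over a complex on \<open>{1..n}\<close>; it is a complex on \<open>{1..n + 1}\<close>.\<close>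

definition cone_complex :: "nat \<Rightarrow> nat set set \<Rightarrow> nat set set" where
  "cone_complex n \<Gamma> = \<Gamma> \<union> {F \<union> {n + 1} | F. F \<in> \<Gamma>}"


section \<open>Reduced simplicial homology over a field\<close>

text \<open>A chain of degree \<open>i\<close> is its family of coefficients, extended by zero to all sets of
  naturals. In degree \<open>-1\<close> the only possible face is the empty set, so this is the augmented
  (reduced) chain complex. The modules below are records of HOL-Algebra; their ring
  multiplication and unit are irrelevant.\<close>

definition chains :: "int \<Rightarrow> nat set set \<Rightarrow> (nat set \<Rightarrow> 'k::field) set" where
  "chains i \<Gamma> = {c. \<forall>F. F \<notin> faces i \<Gamma> \<longrightarrow> c F = 0}"

text \<open>Each face is oriented by the order of its vertices: deleting the vertex \<open>v\<close> from \<open>F\<close>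
  contributes with the sign given by the number of vertices of \<open>F\<close> preceding \<open>v\<close>.\<close>

definition boundary :: "nat set set \<Rightarrow> (nat set \<Rightarrow> 'k::field) \<Rightarrow> (nat set \<Rightarrow> 'k)" where
  "boundary \<Gamma> c = (\<lambda>G. \<Sum>F\<in>\<Gamma>. \<Sum>v\<in>F.
     if F - {v} = G then (-1) ^ card {u\<in>F. u < v} * c F else 0)"

definition cycles :: "int \<Rightarrow> nat set set \<Rightarrow> (nat set \<Rightarrow> 'k::field) set" where
  "cycles i \<Gamma> = {c \<in> chains i \<Gamma>. boundary \<Gamma> c = (\<lambda>_. 0)}"

definition boundaries :: "int \<Rightarrow> nat set set \<Rightarrow> (nat set \<Rightarrow> 'k::field) set" where
  "boundaries i \<Gamma> = boundary \<Gamma> ` chains (i + 1) \<Gamma>"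

definition cycle_space :: "int \<Rightarrow> nat set set \<Rightarrow> ('k::field, nat set \<Rightarrow> 'k) module" where
  "cycle_space i \<Gamma> =
    \<lparr>carrier = cycles i \<Gamma>, mult = undefined, one = undefined,
     zero = (\<lambda>_. 0), add = (\<lambda>c d F. c F + d F), smult = (\<lambda>a c F. a * c F)\<rparr>"

text \<open>The quotient of a module \<open>M\<close> by a submodule \<open>N\<close>, following
  \<^const>\<open>A_FactGroup\<close>. A scalar acts through representatives, because the
  elementwise multiple of a coset by the scalar zero is not a coset.\<close>

definition quotient_module :: "('a, 'b) module \<Rightarrow> 'b set \<Rightarrow> ('a, 'b set) module" where
  "quotient_module M N =
    \<lparr>carrier = a_rcosets\<^bsub>M\<^esub> N, mult = undefined, one = undefined,
     zero = N, add = set_add M, smult = (\<lambda>a X. \<Union>x\<in>X. N +>\<^bsub>M\<^esub> (a \<odot>\<^bsub>M\<^esub> x))\<rparr>"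

definition reduced_homology ::
    "int \<Rightarrow> nat set set \<Rightarrow> ('k::field, (nat set \<Rightarrow> 'k) set) module" where
  "reduced_homology i \<Gamma> = quotient_module (cycle_space i \<Gamma>) (boundaries i \<Gamma>)"

definition betti :: "'k::field itself \<Rightarrow> int \<Rightarrow> nat set set \<Rightarrow> nat" where
  "betti K i \<Gamma> =
    vectorspace.dim (class_ring :: 'k ring)
      (reduced_homology i \<Gamma> :: ('k, (nat set \<Rightarrow> 'k) set) module)"

end

theory Submission
  imports Defs
begin

text \<open>A face \<open>F\<close> of a shifted complex on \<open>[n]\<close> is free if neither does it contain \<open>n\<close> nor is
  \<open>insert n F\<close> a face. Free faces are facets; coning with apex \<open>n\<close> contracts every cycle that
  vanishes on them, so the free faces of dimension \<open>i\<close> number the \<open>i\<close>-th reduced Betti number.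
  The theorem follows by induction on \<open>n\<close>. Let \<open>D\<close> and \<open>L\<close> be the deletion and the link of the
  last vertex of \<open>\<Gamma>\<close>; the free faces are \<open>D - L\<close>. As cone \<open>L \<subseteq> \<Gamma> \<subseteq>\<close> cone \<open>D\<close> and \<open>\<Delta>\<close> fixes both
  cones, the deletion \<open>D'\<close> and the link \<open>L'\<close> of \<open>\<Delta> \<Gamma>\<close> satisfy \<open>L \<subseteq> L' \<subseteq> D' \<subseteq> D\<close>. The Betti
  inequality says \<open>card (D - L) \<le> card (D' - L')\<close>, which forces \<open>D' = D\<close> and \<open>L' = L\<close>.\<close>

section \<open>Dimension of a quotient by an evaluation kernel\<close>

text \<open>Only \<open>V\<close> is known to be a vector space. The axioms for \<open>W\<close> are
  pulled back along \<open>f\<close>, so a quotient module can be handled through a bijection with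
  coordinate vectors.\<close>

lemma vectorspace_transport:
  assumes V: "vectorspace K V" and fd: "vectorspace.fin_dim K V"
    and bij: "bij_betw f (carrier V) (carrier W)"
    and add: "\<And>v w. v \<in> carrier V \<Longrightarrow> w \<in> carrier V \<Longrightarrow> f (v \<oplus>\<^bsub>V\<^esub> w) = f v \<oplus>\<^bsub>W\<^esub> f w"
    and smult: "\<And>a v. a \<in> carrier K \<Longrightarrow> v \<in> carrier V \<Longrightarrow> f (a \<odot>\<^bsub>V\<^esub> v) = a \<odot>\<^bsub>W\<^esub> f v"
    and zero: "f \<zero>\<^bsub>V\<^esub> = \<zero>\<^bsub>W\<^esub>"
  shows "vectorspace.dim K W = vectorspace.dim K V"
proof -
  interpret V: vectorspace K V by fact
  have W: "carrier W = f ` carrier V" and inj: "inj_on f (carrier V)"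
    using bij by (auto simp: bij_betw_def)
  have "vectorspace K W"
  proof (rule vs_criteria)
    show "field K" by (rule V.field.field_axioms)
    show "\<forall>v\<in>carrier W. \<exists>neg_v\<in>carrier W. v \<oplus>\<^bsub>W\<^esub> neg_v = \<zero>\<^bsub>W\<^esub>"
    proof
      fix v assume "v \<in> carrier W"
      then obtain x where x: "x \<in> carrier V" "v = f x" using W by auto
      have "v \<oplus>\<^bsub>W\<^esub> f (\<ominus>\<^bsub>V\<^esub> x) = f (x \<oplus>\<^bsub>V\<^esub> \<ominus>\<^bsub>V\<^esub> x)" using x add by simp
      also have "\<dots> = \<zero>\<^bsub>W\<^esub>" using x zero by (simp add: V.M.r_neg)
      finally show "\<exists>neg_v\<in>carrier W. v \<oplus>\<^bsub>W\<^esub> neg_v = \<zero>\<^bsub>W\<^esub>" using x W by auto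
    qed
  qed (auto simp: W V.M.a_ac V.smult_assoc1 V.smult_l_distr V.smult_r_distr simp flip: add smult zero)
  then interpret W: vectorspace K W .
  have "f \<in> LinearCombinations.module_hom K V W"
    by (auto simp: LinearCombinations.module_hom_def W add smult)
  then interpret linear_map K V W f
    by (intro linear_map.intro mod_hom.intro mod_hom_axioms.intro
        V.vectorspace_axioms W.vectorspace_axioms V.module_axioms W.module_axioms)
  show ?thesis using dim_eq[OF fd inj W[symmetric]] by simp
qed

text \<open>Evaluation at the points of \<open>B\<close> maps \<open>Z\<close> linearly to the
  functions on \<open>B\<close>. Its kernel is \<open>N\<close>, and the dual elements make it
  surjective, so the quotient is a coordinate space with one coordinate per point of
  \<open>B\<close>.\<close>

lemma dim_quotient_evaluation:
  fixes Z N :: "('a \<Rightarrow> 'k::field) set" and B :: "'a set"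
  defines "M \<equiv> \<lparr>carrier = Z, mult = undefined, one = undefined, zero = (\<lambda>_. 0),
     add = (\<lambda>c d F. c F + d F), smult = (\<lambda>a c F. a * c F)\<rparr> :: ('k, 'a \<Rightarrow> 'k) module"
  assumes Z0: "(\<lambda>_. 0) \<in> Z"
    and Zadd: "\<And>c d. c \<in> Z \<Longrightarrow> d \<in> Z \<Longrightarrow> (\<lambda>F. c F + d F) \<in> Z"
    and Zsmult: "\<And>a c. c \<in> Z \<Longrightarrow> (\<lambda>F. a * c F) \<in> Z"
    and B: "finite B"
    and N: "N = {z \<in> Z. \<forall>x\<in>B. z x = 0}"
    and dual: "\<And>x. x \<in> B \<Longrightarrow> \<exists>z\<in>Z. z x = 1 \<and> (\<forall>y\<in>B - {x}. z y = 0)"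
  shows "vectorspace.dim (class_ring :: 'k ring) (quotient_module M N) = card B"
proof -
  define m where "m = card B"
  obtain b where b: "bij_betw b {0..<m} B"
    using B ex_bij_betw_nat_finite m_def by blast
  \<comment> \<open>The inverse of the evaluation isomorphism: \<open>f v\<close> is the fibre over
    \<open>v\<close>, which is itself a coset of \<open>N\<close>.\<close>
  define f where "f v = {z \<in> Z. \<forall>j<m. z (b j) = v $ j}" for v :: "'k vec"
  interpret V: vec_space "TYPE('k)" m .
  have ballB: "(\<forall>x\<in>B. P x) \<longleftrightarrow> (\<forall>j<m. P (b j))" for P
    using b by (auto simp: bij_betw_def)
  have Zdiff: "(\<lambda>F. c F - d F) \<in> Z" if "c \<in> Z" "d \<in> Z" for c d
    using Zadd[OF that(1) Zsmult[OF that(2), of "- 1"]] by simp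
  have coset: "a_r_coset M N z = {w \<in> Z. \<forall>j<m. w (b j) = z (b j)}" if z: "z \<in> Z" for z
  proof -
    have "a_r_coset M N z = (\<lambda>d F. d F + z F) ` N"
      by (auto simp: a_r_coset_def r_coset_def M_def)
    also have "\<dots> = {w \<in> Z. \<forall>j<m. w (b j) = z (b j)}"
    proof safe
      fix w assume w: "w \<in> Z" "\<forall>j<m. w (b j) = z (b j)"
      have "(\<lambda>F. w F - z F) \<in> N"
        using w z Zdiff by (auto simp: N ballB)
      then show "w \<in> (\<lambda>d F. d F + z F) ` N"
        by (rule rev_image_eqI) auto
    qed (use z Zadd in \<open>auto simp: N ballB\<close>)
    finally show ?thesis .
  qed
  have coset_f: "a_r_coset M N z = f (vec m (\<lambda>j. z (b j)))" if "z \<in> Z" for z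
    using that by (auto simp: coset f_def)
  have fibre: "\<exists>z. z \<in> f v" for v
  proof -
    obtain e where e: "\<And>x. x \<in> B \<Longrightarrow> e x \<in> Z \<and> e x x = 1 \<and> (\<forall>y\<in>B - {x}. e x y = 0)"
      using dual by metis
    \<comment> \<open>The preimage of \<open>v\<close> is the combination of dual elements with
      coefficients \<open>v $ j\<close>. Closure under addition is binary, hence the induction on
      the number of terms.\<close>
    have Zsum: "(\<lambda>F. \<Sum>j<k. v $ j * e (b j) F) \<in> Z" if "k \<le> m" for k
      using that
    proof (induction k)
      case (Suc k)
      then have "b k \<in> B" using b by (auto simp: bij_betw_def)
      then show ?case using Suc Zadd[OF _ Zsmult[of "e (b k)" "v $ k"]] e by simp
    qed (use Z0 in simp)
    have "(\<Sum>j<m. v $ j * e (b j) (b k)) = v $ k" if k: "k < m" for k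
    proof -
      have "e (b j) (b k) = (if j = k then 1 else 0)" if "j < m" for j
      proof -
        have "b j \<in> B" "b k \<in> B" using b k that by (auto simp: bij_betw_def)
        moreover have "b j = b k \<Longrightarrow> j = k"
          using b k that by (auto simp: bij_betw_def inj_on_def)
        ultimately show ?thesis using e[of "b j"] by auto
      qed
      then have "(\<Sum>j<m. v $ j * e (b j) (b k)) = (\<Sum>j<m. if j = k then v $ j else 0)"
        by (intro sum.cong) auto
      then show ?thesis using k by simp
    qed
    then show ?thesis using Zsum[of m] unfolding f_def by auto
  qed
  have f_coset: "f v = a_r_coset M N z" if "z \<in> f v" for v z
    using that by (auto simp: coset f_def)
  have in_Z: "z \<in> Z" if "z \<in> f v" for v z
    using that by (simp add: f_def)
  have "vectorspace.dim class_ring (quotient_module M N)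
      = vectorspace.dim class_ring (module_vec TYPE('k) m)"
  proof (rule vectorspace_transport[where f = f])
    show "bij_betw f (carrier (module_vec TYPE('k) m)) (carrier (quotient_module M N))"
    proof (rule bij_betw_imageI)
      show "inj_on f (carrier (module_vec TYPE('k) m))"
      proof (rule inj_onI)
        fix v w assume vw: "v \<in> carrier (module_vec TYPE('k) m)" "w \<in> carrier (module_vec TYPE('k) m)"
          and eq: "f v = f w"
        obtain z where z: "z \<in> f v" using fibre by blast
        then have "z \<in> f w" using eq by simp
        with z have "v $ i = w $ i" if "i < m" for i
          using that by (simp add: f_def)
        with vw show "v = w"
          by (intro eq_vecI) (auto simp: module_vec_simps)
      qed
      have rc: "a_rcosets\<^bsub>M\<^esub> N = (\<lambda>z. a_r_coset M N z) ` Z"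
        by (auto simp: A_RCOSETS_def RCOSETS_def a_r_coset_def M_def)
      show "f ` carrier (module_vec TYPE('k) m) = carrier (quotient_module M N)"
      proof (intro equalityI subsetI)
        fix X assume "X \<in> f ` carrier (module_vec TYPE('k) m)"
        then show "X \<in> carrier (quotient_module M N)"
          using fibre f_coset in_Z by (fastforce simp: quotient_module_def rc)
      qed (auto simp: quotient_module_def rc coset_f module_vec_simps)
    qed
  next
    fix v w assume vw: "v \<in> carrier (module_vec TYPE('k) m)" "w \<in> carrier (module_vec TYPE('k) m)"
    obtain x where x: "x \<in> f v" using fibre by blast
    have "f (v + w) = {h. \<exists>c\<in>f v. \<exists>d\<in>f w. h = (\<lambda>F. c F + d F)}"
    proof (intro equalityI subsetI)
      fix u assume u: "u \<in> f (v + w)"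
      \<comment> \<open>Splitting \<open>u\<close> as \<open>x + (u - x)\<close> with the fixed
        \<open>x\<close> in the fibre over \<open>v\<close> leaves a summand in the fibre over
        \<open>w\<close>.\<close>
      have "(\<lambda>F. u F - x F) \<in> f w"
        using u x vw Zdiff by (auto simp: f_def module_vec_simps)
      then show "u \<in> {h. \<exists>c\<in>f v. \<exists>d\<in>f w. h = (\<lambda>F. c F + d F)}"
        using x by force
    qed (use vw Zadd in \<open>auto simp: f_def module_vec_simps\<close>)
    then show "f (v \<oplus>\<^bsub>module_vec TYPE('k) m\<^esub> w) = f v \<oplus>\<^bsub>quotient_module M N\<^esub> f w"
      by (auto simp: quotient_module_def set_add_def set_mult_def M_def module_vec_simps)
  next
    fix a v assume v: "v \<in> carrier (module_vec TYPE('k) m)"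
    \<comment> \<open>All representatives yield the same scaled coset, so the union in the scalar
      action collapses, the fibre being nonempty.\<close>
    have "a_r_coset M N (\<lambda>F. a * x F) = f (a \<cdot>\<^sub>v v)" if "x \<in> f v" for x
      using that v Zsmult by (auto simp: f_def coset module_vec_simps)
    then show "f (a \<odot>\<^bsub>module_vec TYPE('k) m\<^esub> v) = a \<odot>\<^bsub>quotient_module M N\<^esub> f v"
      using fibre[of v] by (auto simp: quotient_module_def M_def module_vec_simps)
  next
    show "f \<zero>\<^bsub>module_vec TYPE('k) m\<^esub> = \<zero>\<^bsub>quotient_module M N\<^esub>"
      by (auto simp: quotient_module_def f_def N ballB module_vec_simps)
  qed (use V.fin_dim in \<open>auto intro: vec_vs\<close>)
  then show ?thesis using V.dim_is_n m_def by simp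
qed


section \<open>Homology of shifted complexes\<close>

definition orientation :: "nat \<Rightarrow> nat set \<Rightarrow> 'k::field" where
  "orientation v G = (- 1) ^ card {u \<in> G. u < v}"

text \<open>The boundary map of the full simplex on [n], summed over the cofaces of the target
  \<open>G\<close>. Not depending on a complex, it also applies to a simplex missing from the
  complex.\<close>

definition simplex_boundary :: "nat \<Rightarrow> (nat set \<Rightarrow> 'k::field) \<Rightarrow> nat set \<Rightarrow> 'k" where
  "simplex_boundary n c G = (\<Sum>v\<in>{1..n} - G. orientation v G * c (insert v G))"

text \<open>The contracting homotopy with apex \<open>n\<close>. When \<open>n\<close> is the last
  vertex, the sign counts the vertices preceding it.\<close>

definition cone_operator :: "nat \<Rightarrow> (nat set \<Rightarrow> 'k::field) \<Rightarrow> nat set \<Rightarrow> 'k" where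
  "cone_operator n c G = (if n \<in> G then (- 1) ^ card (G - {n}) * c (G - {n}) else 0)"

lemma orientation_square: "orientation v G * orientation v G = (1 :: 'k::field)"
  by (simp add: orientation_def flip: power_mult_distrib)

text \<open>The vertices below \<open>v\<close> do not change. The case \<open>w = v\<close> lets
  the sign of a deletion be read off from the smaller face.\<close>

lemma orientation_insert_ge:
  "v \<le> w \<Longrightarrow> orientation v (insert w G) = orientation v G"
  unfolding orientation_def by (rule arg_cong[where f = "\<lambda>A. (- 1) ^ card A"]) auto

lemma orientation_insert_less:
  assumes "w < v" "w \<notin> G"
  shows "orientation v (insert w G) = - (orientation v G :: 'k::field)"
proof -
  have "{u \<in> insert w G. u < v} = insert w {u \<in> G. u < v}" using assms by auto
  then show ?thesis using assms by (simp add: orientation_def)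
qed

lemma orientation_apex:
  assumes "G \<subseteq> {1..n}" "n \<notin> G"
  shows "orientation n G = ((- 1) ^ card G :: 'k::field)"
proof -
  have "u < n" if "u \<in> G" for u
    using assms that by (metis atLeastAtMost_iff le_neq_implies_less subsetD)
  then have "{u \<in> G. u < n} = G" by auto
  then show ?thesis by (simp add: orientation_def)
qed

text \<open>Two missing vertices can be inserted in either order, and the two orders carry opposite
  signs: inserting the smaller one first flips the sign of the larger.\<close>

lemma simplex_boundary_boundary:
  "simplex_boundary n (simplex_boundary n c) G = (0 :: 'k::field)"
proof -
  define A where "A = {1..n} - G"
  have fin: "finite A" by (simp add: A_def)
  define g where "g v w = orientation v G * orientation w (insert v G) * c (insert w (insert v G))"
    for v w
  have anti: "g v w + g w v = 0" if "v \<in> A" "w \<in> A" "v < w" for v w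
    using that by (simp add: g_def A_def orientation_insert_ge orientation_insert_less
        insert_commute[of v w])
  have "simplex_boundary n (simplex_boundary n c) G = (\<Sum>v\<in>A. \<Sum>w\<in>A - {v}. g v w)"
    unfolding simplex_boundary_def A_def g_def sum_distrib_left
    by (intro sum.cong refl) (auto simp: mult.assoc)
  \<comment> \<open>Ordered pairs are split by which vertex is smaller. Exchanging the sums in the
    second half matches \<open>g w v\<close> with \<open>g v w\<close>.\<close>
  also have "\<dots> = (\<Sum>v\<in>A. (\<Sum>w\<in>{w\<in>A. v < w}. g v w) + (\<Sum>w\<in>{w\<in>A. w < v}. g v w))"
  proof (rule sum.cong[OF refl])
    fix v assume "v \<in> A"
    have "A - {v} = {w\<in>A. v < w} \<union> {w\<in>A. w < v}" by auto
    then show "(\<Sum>w\<in>A - {v}. g v w)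
        = (\<Sum>w\<in>{w\<in>A. v < w}. g v w) + (\<Sum>w\<in>{w\<in>A. w < v}. g v w)"
      using fin by (simp add: sum.union_disjoint disjoint_iff)
  qed
  also have "\<dots> = (\<Sum>v\<in>A. \<Sum>w\<in>{w\<in>A. v < w}. g v w) + (\<Sum>v\<in>A. \<Sum>w\<in>{w\<in>A. w < v}. g v w)"
    by (rule sum.distrib)
  also have "(\<Sum>v\<in>A. \<Sum>w\<in>{w\<in>A. w < v}. g v w) = (\<Sum>v\<in>A. \<Sum>w\<in>{w\<in>A. v < w}. g w v)"
    using fin by (rule sum.swap_restrict) (rule fin)
  also have "(\<Sum>v\<in>A. \<Sum>w\<in>{w\<in>A. v < w}. g v w) + \<dots> = 0"
    by (simp add: anti flip: sum.distrib)
  finally show ?thesis .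
qed

text \<open>The homotopy identity. If \<open>n\<close> is not in \<open>G\<close>, only the
  insertion of \<open>n\<close> survives. If it is, the insertions of the other vertices cancel
  between the two summands.\<close>

lemma simplex_boundary_cone_operator:
  assumes G: "G \<subseteq> {1..n}" and n: "n \<ge> 1"
  shows "simplex_boundary n (cone_operator n c) G + cone_operator n (simplex_boundary n c) G
    = (c G :: 'k::field)"
proof (cases "n \<in> G")
  case False
  have "simplex_boundary n (cone_operator n c) G
      = (\<Sum>v\<in>{1..n} - G. if v = n then orientation n G * ((- 1) ^ card G * c G) else 0)"
    unfolding simplex_boundary_def
    by (intro sum.cong) (use False in \<open>auto simp: cone_operator_def\<close>)
  also have "\<dots> = orientation n G * ((- 1) ^ card G * c G)"
    using n False by simp
  also have "\<dots> = c G"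
    using orientation_square[of n G, where 'k = 'k] orientation_apex[OF G False, where 'k = 'k]
    by (simp flip: mult.assoc)
  finally show ?thesis using False by (simp add: cone_operator_def)
next
  case True
  define H where "H = G - {n}"
  have G_eq: "G = insert n H" and nH: "n \<notin> H" using True by (auto simp: H_def)
  have H: "H \<subseteq> {1..n}" "finite H" using G by (auto simp: H_def intro: finite_subset)
  let ?s = "(- 1) ^ card H :: 'k"
  let ?S = "\<Sum>v\<in>{1..n} - G. orientation v H * c (insert v H)"
  \<comment> \<open>The minus sign arises because \<open>insert v H\<close> has one more vertex than
    \<open>H\<close>.\<close>
  have "simplex_boundary n (cone_operator n c) G = (\<Sum>v\<in>{1..n} - G. - ?s * (orientation v H * c (insert v H)))"
    unfolding simplex_boundary_def
  proof (rule sum.cong[OF refl])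
    fix v assume v: "v \<in> {1..n} - G"
    then have "insert v G - {n} = insert v H" "v \<notin> H" "v \<le> n" using True by (auto simp: H_def)
    then show "orientation v G * cone_operator n c (insert v G) = - ?s * (orientation v H * c (insert v H))"
      using True H by (simp add: cone_operator_def G_eq orientation_insert_ge)
  qed
  also have "\<dots> = - ?s * ?S" by (simp add: sum_distrib_left)
  finally have 1: "simplex_boundary n (cone_operator n c) G = - ?s * ?S" .
  \<comment> \<open>For \<open>H\<close> the apex is an additional missing vertex; its insertion
    gives back \<open>G\<close> and is the term that survives.\<close>
  have "{1..n} - H = insert n ({1..n} - G)" using n by (auto simp: H_def)
  then have "simplex_boundary n c H = (\<Sum>v\<in>insert n ({1..n} - G). orientation v H * c (insert v H))"
    by (simp only: simplex_boundary_def)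
  also have "\<dots> = ?s * c G + ?S"
    using True H nH by (simp add: orientation_apex flip: G_eq)
  finally have "simplex_boundary n c H = ?s * c G + ?S" .
  then have "cone_operator n (simplex_boundary n c) G = ?s * (?s * c G + ?S)"
    using True by (simp add: cone_operator_def H_def)
  moreover have "?s * (?s * c G) = c G"
    by (simp flip: mult.assoc power_mult_distrib)
  ultimately show ?thesis using 1 by (simp add: distrib_left)
qed

section \<open>Chains of a complex inside the full simplex\<close>

lemma simplicial_complex_finite:
  "simplicial_complex n \<Gamma> \<Longrightarrow> finite \<Gamma>"
  unfolding simplicial_complex_def by (meson finite_Pow_iff finite_atLeastAtMost finite_subset)

lemma simplicial_complex_mono:
  "simplicial_complex n \<Gamma> \<Longrightarrow> F \<in> \<Gamma> \<Longrightarrow> G \<subseteq> F \<Longrightarrow> G \<in> \<Gamma>"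
  by (auto simp: simplicial_complex_def)

lemma simplicial_complex_face:
  "simplicial_complex n \<Gamma> \<Longrightarrow> F \<in> \<Gamma> \<Longrightarrow> F \<subseteq> {1..n} \<and> finite F"
  unfolding simplicial_complex_def by (meson Pow_iff finite_atLeastAtMost finite_subset subsetD)

lemma shiftedD:
  "shifted n \<Gamma> \<Longrightarrow> F \<in> \<Gamma> \<Longrightarrow> i \<in> F \<Longrightarrow> i < j \<Longrightarrow> j \<le> n \<Longrightarrow> insert j (F - {i}) \<in> \<Gamma>"
  by (auto simp: shifted_def)

lemma chains_supp:
  "c \<in> chains i \<Gamma> \<Longrightarrow> c F \<noteq> 0 \<Longrightarrow> F \<in> \<Gamma> \<and> face_dim F = i"
  by (auto simp: chains_def faces_def)

lemma chainsI:
  "(\<And>F. c F \<noteq> 0 \<Longrightarrow> F \<in> \<Gamma> \<and> face_dim F = i) \<Longrightarrow> c \<in> chains i \<Gamma>"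
  by (auto simp: chains_def faces_def)

lemma face_dim_insert: "finite G \<Longrightarrow> v \<notin> G \<Longrightarrow> face_dim (insert v G) = face_dim G + 1"
  by (simp add: face_dim_def)

text \<open>Summing over all cofaces in the simplex adds nothing, since a chain vanishes outside the
  complex.\<close>

lemma boundary_eq_simplex_boundary:
  fixes c :: "nat set \<Rightarrow> 'k::field"
  assumes \<Gamma>: "simplicial_complex n \<Gamma>" and c: "c \<in> chains i \<Gamma>"
  shows "boundary \<Gamma> c = simplex_boundary n c"
proof
  fix G
  have fin: "finite \<Gamma>" using \<Gamma> by (rule simplicial_complex_finite)
  let ?t = "\<lambda>F v. if F = insert v G \<and> v \<notin> G then orientation v G * c (insert v G) else 0"
  have "boundary \<Gamma> c G = (\<Sum>F\<in>\<Gamma>. \<Sum>v\<in>{1..n}. ?t F v)"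
    unfolding boundary_def orientation_def[symmetric]
  proof (rule sum.cong[OF refl])
    fix F assume F: "F \<in> \<Gamma>"
    have eq: "(if F - {v} = G then orientation v F * c F else 0) = ?t F v"
      if "v \<in> F" for v
    proof -
      have "F - {v} = G \<longleftrightarrow> F = insert v G \<and> v \<notin> G" using that by auto
      then show ?thesis
        by (auto simp: orientation_insert_ge)
    qed
    have "(\<Sum>v\<in>F. if F - {v} = G then orientation v F * c F else 0) = (\<Sum>v\<in>F. ?t F v)"
      by (rule sum.cong[OF refl]) (rule eq)
    also have "\<dots> = (\<Sum>v\<in>{1..n}. ?t F v)"
      using simplicial_complex_face[OF \<Gamma> F] by (intro sum.mono_neutral_left) auto
    finally show "(\<Sum>v\<in>F. if F - {v} = G then orientation v F * c F else 0)
      = (\<Sum>v\<in>{1..n}. ?t F v)" .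
  qed
  also have "\<dots> = (\<Sum>v\<in>{1..n}. \<Sum>F\<in>\<Gamma>. ?t F v)" by (rule sum.swap)
  also have "\<dots> = (\<Sum>v\<in>{1..n}. if v \<notin> G then orientation v G * c (insert v G) else 0)"
  proof (rule sum.cong[OF refl])
    fix v
    have "(\<Sum>F\<in>\<Gamma>. ?t F v)
        = (\<Sum>F\<in>\<Gamma>. if F = insert v G then (if v \<notin> G then orientation v G * c (insert v G) else 0) else 0)"
      by (rule sum.cong) auto
    also have "\<dots> = (if v \<notin> G then orientation v G * c (insert v G) else 0)"
      using fin chains_supp[OF c] by auto
    finally show "(\<Sum>F\<in>\<Gamma>. ?t F v) = (if v \<notin> G then orientation v G * c (insert v G) else 0)" .
  qed
  also have "\<dots> = simplex_boundary n c G"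
    unfolding simplex_boundary_def by (simp add: sum.inter_filter[symmetric] set_diff_eq)
  finally show "boundary \<Gamma> c G = simplex_boundary n c G" .
qed

lemma simplex_boundary_supp:
  assumes "simplex_boundary n c G \<noteq> 0"
  obtains v where "v \<in> {1..n}" "v \<notin> G" "c (insert v G) \<noteq> 0"
  using assms unfolding simplex_boundary_def
  by (metis (no_types, lifting) DiffE mult_eq_0_iff sum.neutral)

lemma simplex_boundary_chains:
  assumes \<Gamma>: "simplicial_complex n \<Gamma>" and c: "c \<in> chains (i + 1) \<Gamma>"
  shows "simplex_boundary n c \<in> chains i \<Gamma>"
proof (rule chainsI)
  fix G assume "simplex_boundary n c G \<noteq> 0"
  then obtain v where v: "v \<notin> G" "c (insert v G) \<noteq> 0" by (rule simplex_boundary_supp)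
  then have F: "insert v G \<in> \<Gamma>" "face_dim (insert v G) = i + 1"
    using chains_supp[OF c] by auto
  then have "finite G" using simplicial_complex_face[OF \<Gamma> F(1)] by simp
  then show "G \<in> \<Gamma> \<and> face_dim G = i"
    using F v simplicial_complex_mono[OF \<Gamma> F(1)] by (auto simp: face_dim_insert)
qed

lemma chains_zero: "(\<lambda>_. 0) \<in> chains i \<Gamma>"
  and chains_add: "c \<in> chains i \<Gamma> \<Longrightarrow> d \<in> chains i \<Gamma> \<Longrightarrow> (\<lambda>F. c F + d F) \<in> chains i \<Gamma>"
  and chains_smult: "c \<in> chains i \<Gamma> \<Longrightarrow> (\<lambda>F. a * c F) \<in> chains i \<Gamma>"
  by (auto simp: chains_def)

lemma simplex_boundary_zero: "simplex_boundary n (\<lambda>_. 0) = (\<lambda>_. 0)"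
  and simplex_boundary_add:
    "simplex_boundary n (\<lambda>F. c F + d F) = (\<lambda>G. simplex_boundary n c G + simplex_boundary n d G)"
  and simplex_boundary_smult:
    "simplex_boundary n (\<lambda>F. a * c F) = (\<lambda>G. a * simplex_boundary n c G)"
  by (auto simp: simplex_boundary_def fun_eq_iff sum.distrib distrib_left sum_distrib_left
      mult.left_commute)

lemma cycles_eq:
  "simplicial_complex n \<Gamma> \<Longrightarrow> cycles i \<Gamma> = {c \<in> chains i \<Gamma>. simplex_boundary n c = (\<lambda>_. 0)}"
  using boundary_eq_simplex_boundary by (fastforce simp: cycles_def)

section \<open>Free faces and Betti numbers\<close>

definition free_faces :: "nat \<Rightarrow> nat set set \<Rightarrow> nat set set" where
  "free_faces n \<Gamma> = {F \<in> \<Gamma>. n \<notin> F \<and> insert n F \<notin> \<Gamma>}"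

text \<open>Shifting a further vertex \<open>v < n\<close> to \<open>n\<close> would put
  \<open>insert n F\<close> into the complex.\<close>

lemma free_face_is_facet:
  assumes \<Gamma>: "simplicial_complex n \<Gamma>" "shifted n \<Gamma>" and F: "F \<in> free_faces n \<Gamma>"
    and v: "v \<in> {1..n}" "v \<notin> F"
  shows "insert v F \<notin> \<Gamma>"
proof
  assume *: "insert v F \<in> \<Gamma>"
  then have "v < n" using F v by (cases "v = n") (auto simp: free_faces_def)
  from shiftedD[OF \<Gamma>(2) * _ this] v have "insert n F \<in> \<Gamma>" by simp
  then show False using F by (simp add: free_faces_def)
qed

text \<open>A boundary vanishes on free faces because they are facets. Conversely, if a cycle
  vanishes there, coning every face of its support stays inside the complex, and by the homotopy
  identity the cone is a chain bounded by the cycle.\<close>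

lemma boundaries_shifted:
  assumes \<Gamma>: "simplicial_complex n \<Gamma>" "shifted n \<Gamma>" and n: "n \<ge> 1"
  shows "(boundaries i \<Gamma> :: (nat set \<Rightarrow> 'k::field) set)
    = {z \<in> cycles i \<Gamma>. \<forall>F\<in>faces i \<Gamma> \<inter> free_faces n \<Gamma>. z F = 0}"
proof (intro equalityI subsetI)
  fix z :: "nat set \<Rightarrow> 'k" assume "z \<in> boundaries i \<Gamma>"
  then obtain c where c: "c \<in> chains (i + 1) \<Gamma>" and z: "z = simplex_boundary n c"
    using boundary_eq_simplex_boundary[OF \<Gamma>(1)] by (auto simp: boundaries_def)
  have "z \<in> cycles i \<Gamma>"
    using simplex_boundary_chains[OF \<Gamma>(1) c]
    by (simp add: cycles_eq[OF \<Gamma>(1)] z fun_eq_iff simplex_boundary_boundary)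
  moreover have "z F = 0" if "F \<in> free_faces n \<Gamma>" for F
  proof (rule ccontr)
    assume "z F \<noteq> 0"
    then obtain v where v: "v \<in> {1..n}" "v \<notin> F" "c (insert v F) \<noteq> 0"
      unfolding z by (rule simplex_boundary_supp)
    then show False using free_face_is_facet[OF \<Gamma> that v(1,2)] chains_supp[OF c] by auto
  qed
  ultimately show "z \<in> {z \<in> cycles i \<Gamma>. \<forall>F\<in>faces i \<Gamma> \<inter> free_faces n \<Gamma>. z F = 0}" by auto
next
  fix z :: "nat set \<Rightarrow> 'k"
  assume "z \<in> {z \<in> cycles i \<Gamma>. \<forall>F\<in>faces i \<Gamma> \<inter> free_faces n \<Gamma>. z F = 0}"
  then have z: "z \<in> chains i \<Gamma>" "simplex_boundary n z = (\<lambda>_. 0)"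
    and van: "\<And>F. F \<in> faces i \<Gamma> \<Longrightarrow> F \<in> free_faces n \<Gamma> \<Longrightarrow> z F = 0"
    by (auto simp: cycles_eq[OF \<Gamma>(1)])
  have h: "cone_operator n z \<in> chains (i + 1) \<Gamma>"
  proof (rule chainsI)
    fix G assume "cone_operator n z G \<noteq> 0"
    then have nG: "n \<in> G" and zG: "z (G - {n}) \<noteq> 0"
      by (auto simp: cone_operator_def split: if_splits)
    from chains_supp[OF z(1) zG] have F: "G - {n} \<in> \<Gamma>" "face_dim (G - {n}) = i" by auto
    then have "G - {n} \<notin> free_faces n \<Gamma>" using van zG by (auto simp: faces_def)
    then have "G \<in> \<Gamma>" using F nG by (auto simp: free_faces_def insert_absorb)
    moreover have "face_dim G = i + 1"
      using face_dim_insert[of "G - {n}" n] F nG simplicial_complex_face[OF \<Gamma>(1) F(1)]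
      by (simp add: insert_absorb)
    ultimately show "G \<in> \<Gamma> \<and> face_dim G = i + 1" by simp
  qed
  have "simplex_boundary n (cone_operator n z) = z"
  proof
    fix G
    show "simplex_boundary n (cone_operator n z) G = z G"
    proof (cases "G \<subseteq> {1..n}")
      case True
      then show ?thesis
        using simplex_boundary_cone_operator[OF True n, of z] z(2)
        by (simp add: cone_operator_def split: if_splits)
    next
      case False
      \<comment> \<open>The homotopy identity covers only subsets of [n]; elsewhere both sides
        vanish as chains of the complex.\<close>
      then have "G \<notin> \<Gamma>" using simplicial_complex_face[OF \<Gamma>(1)] by auto
      then show ?thesis
        using chains_supp[OF z(1)] chains_supp[OF simplex_boundary_chains[OF \<Gamma>(1) h]] by metis
    qed
  qed
  then show "z \<in> boundaries i \<Gamma>"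
    using h boundary_eq_simplex_boundary[OF \<Gamma>(1) h] unfolding boundaries_def
    by (intro image_eqI[of _ _ "cone_operator n z"]) auto
qed

text \<open>The cycle dual to a free face \<open>F\<close> is the boundary of the missing simplex
  \<open>insert n F\<close>: its other facets contain \<open>n\<close>, and lie in the complex because it is shifted.\<close>

lemma free_face_dual_cycle:
  assumes \<Gamma>: "simplicial_complex n \<Gamma>" "shifted n \<Gamma>" and n: "n \<ge> 1"
    and F: "F \<in> faces i \<Gamma>" "F \<in> free_faces n \<Gamma>"
  shows "\<exists>z\<in>cycles i \<Gamma>. z F = (1 :: 'k::field) \<and> (\<forall>H\<in>free_faces n \<Gamma> - {F}. z H = 0)"
proof -
  \<comment> \<open>The coefficient \<open>orientation n F\<close> cancels the sign of deleting
    \<open>n\<close>, so that the boundary takes the value 1 at \<open>F\<close>.\<close>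
  define e :: "nat set \<Rightarrow> 'k" where "e G = (if G = insert n F then orientation n F else 0)" for G
  define z where "z = simplex_boundary n e"
  have F': "F \<in> \<Gamma>" "face_dim F = i" "n \<notin> F" "finite F" "F \<subseteq> {1..n}"
    using F simplicial_complex_face[OF \<Gamma>(1), of F] by (auto simp: faces_def free_faces_def)
  have supp: "\<exists>v. v \<in> {1..n} \<and> v \<notin> G \<and> insert v G = insert n F" if "z G \<noteq> 0" for G
    using that simplex_boundary_supp[of n e G] unfolding z_def e_def by metis
  have "z \<in> chains i \<Gamma>"
  proof (rule chainsI)
    fix G assume "z G \<noteq> 0"
    then obtain v where v: "v \<in> {1..n}" "v \<notin> G" "insert v G = insert n F" using supp by blast
    have "finite G" using v F'(4) by (metis finite_insert)
    then have "face_dim G = i"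
      using face_dim_insert[of G v] face_dim_insert[of F n] v F' by simp
    moreover have "G \<in> \<Gamma>"
    proof (cases "v = n")
      case True
      then show ?thesis using v F' by (metis insert_ident)
    next
      case False
      then have "v \<in> F" "v < n" "G = insert n (F - {v})" using v F' by auto
      then show ?thesis using shiftedD[OF \<Gamma>(2) F'(1)] by auto
    qed
    ultimately show "G \<in> \<Gamma> \<and> face_dim G = i" by simp
  qed
  then have "z \<in> cycles i \<Gamma>"
    by (simp add: cycles_eq[OF \<Gamma>(1)] z_def fun_eq_iff simplex_boundary_boundary)
  moreover have "z F = 1"
  proof -
    have "z F = (\<Sum>v\<in>{1..n} - F. if v = n then 1 else 0)"
      unfolding z_def simplex_boundary_def
      by (rule sum.cong) (use F' in \<open>auto simp: e_def orientation_square insert_ident\<close>)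
    then show ?thesis using n F' by simp
  qed
  moreover have "z H = 0" if H: "H \<in> free_faces n \<Gamma> - {F}" for H
  proof (rule ccontr)
    assume "z H \<noteq> 0"
    then obtain v where v: "v \<notin> H" "insert v H = insert n F" using supp by blast
    have "n \<notin> H" using H by (auto simp: free_faces_def)
    \<comment> \<open>As \<open>H\<close> lacks \<open>n\<close>, the inserted vertex must be
      \<open>n\<close> itself.\<close>
    then have "H = F" using v F' by (metis insertE insertI1 insert_ident)
    then show False using H by simp
  qed
  ultimately show ?thesis by blast
qed

lemma betti_shifted:
  assumes \<Gamma>: "simplicial_complex n \<Gamma>" "shifted n \<Gamma>" and n: "n \<ge> 1"
  shows "betti TYPE('k::field) i \<Gamma> = card (faces i \<Gamma> \<inter> free_faces n \<Gamma>)"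
  unfolding betti_def reduced_homology_def cycle_space_def
proof (rule dim_quotient_evaluation[OF _ _ _ _ boundaries_shifted[OF \<Gamma> n]])
  show "finite (faces i \<Gamma> \<inter> free_faces n \<Gamma>)"
    using simplicial_complex_finite[OF \<Gamma>(1)] by (simp add: faces_def)
  fix F assume "F \<in> faces i \<Gamma> \<inter> free_faces n \<Gamma>"
  then show "\<exists>z\<in>cycles i \<Gamma>. z F = (1 :: 'k) \<and> (\<forall>H\<in>faces i \<Gamma> \<inter> free_faces n \<Gamma> - {F}. z H = 0)"
    using free_face_dual_cycle[OF \<Gamma> n, of F i, where 'k = 'k] by blast
qed (auto simp: cycles_eq[OF \<Gamma>(1)] chains_zero chains_add chains_smult
    simplex_boundary_zero simplex_boundary_add simplex_boundary_smult)

lemma face_dim_bounds: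
  assumes "finite \<Gamma>" "F \<in> \<Gamma>"
  shows "- 1 \<le> face_dim F" "face_dim F \<le> complex_dim \<Gamma>"
  using assms by (auto simp: face_dim_def complex_dim_def)

text \<open>A nonempty face excludes the complex \<open>{{}}\<close>, whose free face
  \<open>{}\<close> has dimension -1 and would escape the sum starting at 0.\<close>

lemma sum_betti_shifted:
  assumes \<Gamma>: "simplicial_complex n \<Gamma>" "shifted n \<Gamma>" and n: "n \<ge> 1"
    and F: "F \<in> \<Gamma>" "F \<noteq> {}"
  shows "(\<Sum>i\<in>{0..complex_dim \<Gamma>}. betti TYPE('k::field) i \<Gamma>) = card (free_faces n \<Gamma>)"
proof -
  have fin: "finite \<Gamma>" using simplicial_complex_finite[OF \<Gamma>(1)] .
  \<comment> \<open>Some vertex is a face and shifts to \<open>{n}\<close>, so the empty face is not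
    free.\<close>
  obtain i where i: "i \<in> F" using F by auto
  then have "{i} \<in> \<Gamma>" using simplicial_complex_mono[OF \<Gamma>(1) F(1)] by auto
  moreover have "i \<le> n" using i simplicial_complex_face[OF \<Gamma>(1) F(1)] by auto
  ultimately have "{n} \<in> \<Gamma>"
    using shiftedD[OF \<Gamma>(2), of "{i}" i n] by (cases "i = n") auto
  then have nonempty: "{} \<notin> free_faces n \<Gamma>" by (auto simp: free_faces_def)
  have dim: "face_dim H \<in> {0..complex_dim \<Gamma>}" if "H \<in> free_faces n \<Gamma>" for H
  proof -
    have "H \<in> \<Gamma>" "H \<noteq> {}" using that nonempty by (auto simp: free_faces_def)
    then have "card H \<ge> 1" using simplicial_complex_face[OF \<Gamma>(1)] by (simp add: Suc_leI card_gt_0_iff)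
    then show ?thesis using face_dim_bounds[OF fin \<open>H \<in> \<Gamma>\<close>] by (simp add: face_dim_def)
  qed
  have "(\<Sum>i\<in>{0..complex_dim \<Gamma>}. betti TYPE('k) i \<Gamma>)
      = (\<Sum>i\<in>{0..complex_dim \<Gamma>}. card (faces i \<Gamma> \<inter> free_faces n \<Gamma>))"
    by (simp add: betti_shifted[OF \<Gamma> n])
  also have "\<dots> = card (\<Union>i\<in>{0..complex_dim \<Gamma>}. faces i \<Gamma> \<inter> free_faces n \<Gamma>)"
    by (rule card_UN_disjoint[symmetric]) (auto simp: faces_def fin)
  also have "(\<Union>i\<in>{0..complex_dim \<Gamma>}. faces i \<Gamma> \<inter> free_faces n \<Gamma>) = free_faces n \<Gamma>"
    using dim by (auto simp: faces_def free_faces_def)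
  finally show ?thesis .
qed


section \<open>Deletion and link of the last vertex\<close>

definition deletion :: "nat \<Rightarrow> nat set set \<Rightarrow> nat set set" where
  "deletion v \<Gamma> = {F \<in> \<Gamma>. v \<notin> F}"

definition link :: "nat \<Rightarrow> nat set set \<Rightarrow> nat set set" where
  "link v \<Gamma> = {F. v \<notin> F \<and> insert v F \<in> \<Gamma>}"

lemma complex_eqI:
  assumes d: "deletion v \<Gamma> = deletion v \<Gamma>'" and l: "link v \<Gamma> = link v \<Gamma>'"
  shows "\<Gamma> = \<Gamma>'"
proof (rule Set.set_eqI)
  fix F
  show "F \<in> \<Gamma> \<longleftrightarrow> F \<in> \<Gamma>'"
  proof (cases "v \<in> F")
    case True
    then have "F \<in> \<Gamma> \<longleftrightarrow> F - {v} \<in> link v \<Gamma>" "F \<in> \<Gamma>' \<longleftrightarrow> F - {v} \<in> link v \<Gamma>'"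
      by (auto simp: link_def insert_absorb)
    then show ?thesis using l by simp
  next
    case False
    then show ?thesis using d by (auto simp: deletion_def)
  qed
qed

lemma link_subset_deletion:
  "simplicial_complex n \<Gamma> \<Longrightarrow> link v \<Gamma> \<subseteq> deletion v \<Gamma>"
  using simplicial_complex_mono by (fastforce simp: link_def deletion_def)

lemma free_faces_eq: "free_faces n \<Gamma> = deletion n \<Gamma> - link n \<Gamma>"
  by (auto simp: free_faces_def deletion_def link_def)

lemma finite_deletion: "simplicial_complex n \<Gamma> \<Longrightarrow> finite (deletion v \<Gamma>)"
  using simplicial_complex_finite by (simp add: deletion_def)

lemma simplicial_complex_restrict:
  assumes "simplicial_complex (n + 1) \<Gamma>"
  shows "simplicial_complex n (deletion (n + 1) \<Gamma>)" "simplicial_complex n (link (n + 1) \<Gamma>)"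
proof -
  have sub: "F \<subseteq> {1..n}" if "F \<in> deletion (n + 1) \<Gamma>" for F
  proof
    fix x assume x: "x \<in> F"
    have "F \<subseteq> {1..n + 1}" "n + 1 \<notin> F"
      using that simplicial_complex_face[OF assms] by (auto simp: deletion_def)
    then have "x \<in> {1..n + 1}" "x \<noteq> n + 1" using x by auto
    then show "x \<in> {1..n}" by auto
  qed
  show "simplicial_complex n (deletion (n + 1) \<Gamma>)"
    unfolding simplicial_complex_def
    using sub simplicial_complex_mono[OF assms] by (auto simp: deletion_def)
  have "G \<in> link (n + 1) \<Gamma>" if "F \<in> link (n + 1) \<Gamma>" "G \<subseteq> F" for F G
    using that simplicial_complex_mono[OF assms, of "insert (n + 1) F" "insert (n + 1) G"]
    by (auto simp: link_def)
  then show "simplicial_complex n (link (n + 1) \<Gamma>)"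
    unfolding simplicial_complex_def using sub link_subset_deletion[OF assms] by blast
qed

lemma shifted_restrict:
  assumes "shifted (n + 1) \<Gamma>"
  shows "shifted n (deletion (n + 1) \<Gamma>)" "shifted n (link (n + 1) \<Gamma>)"
proof -
  show "shifted n (deletion (n + 1) \<Gamma>)"
    using shiftedD[OF assms] by (auto simp: shifted_def deletion_def)
  show "shifted n (link (n + 1) \<Gamma>)"
    unfolding shifted_def
  proof (intro ballI allI impI)
    fix F i j assume F: "F \<in> link (n + 1) \<Gamma>" and ij: "i \<in> F" "i < j \<and> j \<le> n"
    have "insert j (insert (n + 1) F - {i}) \<in> \<Gamma>"
      using F ij by (intro shiftedD[OF assms]) (auto simp: link_def)
    also have "insert j (insert (n + 1) F - {i}) = insert (n + 1) (F - {i} \<union> {j})"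
      using F ij by auto
    finally show "F - {i} \<union> {j} \<in> link (n + 1) \<Gamma>"
      using F ij by (auto simp: link_def)
  qed
qed

section \<open>Cones and the bounds they give\<close>

lemma simplicial_complex_cone:
  assumes "simplicial_complex n \<Gamma>"
  shows "simplicial_complex (n + 1) (cone_complex n \<Gamma>)"
  unfolding simplicial_complex_def
proof (intro conjI ballI allI impI)
  show "cone_complex n \<Gamma> \<subseteq> Pow {1..n + 1}"
    using simplicial_complex_face[OF assms] by (fastforce simp: cone_complex_def)
  fix F G assume "F \<in> cone_complex n \<Gamma>" "G \<subseteq> F"
  then obtain H where "H \<in> \<Gamma>" "G - {n + 1} \<subseteq> H"
    unfolding cone_complex_def by blast
  then have "G - {n + 1} \<in> \<Gamma>" by (rule simplicial_complex_mono[OF assms])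
  then show "G \<in> cone_complex n \<Gamma>"
    by (cases "n + 1 \<in> G") (auto simp: cone_complex_def intro!: exI[of _ "G - {n + 1}"])
qed

lemma deletion_link_cone:
  assumes "simplicial_complex n \<Gamma>"
  shows "deletion (n + 1) (cone_complex n \<Gamma>) = \<Gamma>" "link (n + 1) (cone_complex n \<Gamma>) = \<Gamma>"
proof -
  have apex: "n + 1 \<notin> F" if "F \<in> \<Gamma>" for F
    using simplicial_complex_face[OF assms that] by auto
  then show "deletion (n + 1) (cone_complex n \<Gamma>) = \<Gamma>"
    by (auto simp: deletion_def cone_complex_def)
  show "link (n + 1) (cone_complex n \<Gamma>) = \<Gamma>"
    using apex by (force simp: link_def cone_complex_def insert_ident)
qed

lemma subset_cone_deletion:
  assumes "simplicial_complex (n + 1) \<Gamma>"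
  shows "\<Gamma> \<subseteq> cone_complex n (deletion (n + 1) \<Gamma>)"
proof
  fix F assume F: "F \<in> \<Gamma>"
  then have "F - {n + 1} \<in> deletion (n + 1) \<Gamma>"
    using simplicial_complex_mono[OF assms] by (auto simp: deletion_def)
  then show "F \<in> cone_complex n (deletion (n + 1) \<Gamma>)"
    using F by (cases "n + 1 \<in> F")
      (auto simp: cone_complex_def deletion_def intro!: exI[of _ "F - {n + 1}"])
qed

lemma cone_link_subset:
  assumes "simplicial_complex (n + 1) \<Gamma>"
  shows "cone_complex n (link (n + 1) \<Gamma>) \<subseteq> \<Gamma>"
  using link_subset_deletion[OF assms] by (auto simp: cone_complex_def link_def deletion_def)

section \<open>Counting faces\<close>

lemma sum_list_f_vector:
  assumes "finite \<Gamma>"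
  shows "sum_list (f_vector \<Gamma>) = card \<Gamma>"
proof -
  have "sum_list (f_vector \<Gamma>) = (\<Sum>i\<in>{-1..complex_dim \<Gamma>}. card (faces i \<Gamma>))"
    unfolding f_vector_def by (subst sum_list_distinct_conv_sum_set) auto
  also have "\<dots> = card (\<Union>i\<in>{-1..complex_dim \<Gamma>}. faces i \<Gamma>)"
    by (rule card_UN_disjoint[symmetric]) (auto simp: faces_def assms)
  also have "(\<Union>i\<in>{-1..complex_dim \<Gamma>}. faces i \<Gamma>) = \<Gamma>"
    using face_dim_bounds[OF assms] by (auto simp: faces_def)
  finally show ?thesis .
qed

text \<open>A nonempty complex contains \<open>{}\<close>, so a lone face must be \<open>{}\<close>.
  Triviality is thus visible in the number of faces, which \<open>\<Delta>\<close>
  preserves.\<close>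

lemma trivial_complex_iff_card:
  assumes "simplicial_complex n \<Gamma>"
  shows "\<Gamma> \<subseteq> {{}} \<longleftrightarrow> card \<Gamma> \<le> 1"
proof
  show "\<Gamma> \<subseteq> {{}} \<Longrightarrow> card \<Gamma> \<le> 1" using card_mono[of "{{}}" \<Gamma>] by simp
  assume "card \<Gamma> \<le> 1"
  moreover have "{} \<in> \<Gamma>" if "F \<in> \<Gamma>" for F
    using simplicial_complex_mono[OF assms that] by simp
  ultimately show "\<Gamma> \<subseteq> {{}}"
    using card_le_Suc0_iff_eq[OF simplicial_complex_finite[OF assms]] by auto
qed

section \<open>Induction on the number of vertices\<close>

theorem theorem1p1:
  fixes \<Delta> :: "nat \<Rightarrow> nat set set \<Rightarrow> nat set set"
  assumes "\<And>n \<Gamma>. simplicial_complex n \<Gamma> \<Longrightarrow> simplicial_complex n (\<Delta> n \<Gamma>) \<and> shifted n (\<Delta> n \<Gamma>)"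
    and "\<And>n \<Gamma>. simplicial_complex n \<Gamma> \<Longrightarrow> f_vector (\<Delta> n \<Gamma>) = f_vector \<Gamma>"
    and "\<And>n \<Gamma>. simplicial_complex n \<Gamma> \<Longrightarrow>
           \<Delta> (n + 1) (cone_complex n \<Gamma>) = cone_complex n (\<Delta> n \<Gamma>)"
    and "\<And>n \<Gamma> \<Gamma>'. simplicial_complex n \<Gamma> \<Longrightarrow> simplicial_complex n \<Gamma>' \<Longrightarrow>
           \<Gamma>' \<subseteq> \<Gamma> \<Longrightarrow> \<Delta> n \<Gamma>' \<subseteq> \<Delta> n \<Gamma>"
    and "\<And>n \<Gamma>. simplicial_complex n \<Gamma> \<Longrightarrow>
           (\<Sum>i\<in>{0..complex_dim \<Gamma>}. betti TYPE('k::field) i \<Gamma>)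
             \<le> (\<Sum>i\<in>{0..complex_dim (\<Delta> n \<Gamma>)}. betti TYPE('k) i (\<Delta> n \<Gamma>))"
    and "simplicial_complex n \<Gamma>" and "shifted n \<Gamma>"
  shows "\<Delta> n \<Gamma> = \<Gamma>"
proof -
  note \<Delta> = assms(1)[THEN conjunct1] and \<Delta>_shifted = assms(1)[THEN conjunct2]
    and \<Delta>_f = assms(2) and \<Delta>_cone = assms(3) and \<Delta>_mono = assms(4) and \<Delta>_betti = assms(5)
  have card: "card (\<Delta> n \<Gamma>) = card \<Gamma>" if "simplicial_complex n \<Gamma>" for n \<Gamma>
    using sum_list_f_vector simplicial_complex_finite that \<Delta>[OF that] \<Delta>_f[OF that] by metis
  have trivial: "\<Delta> n \<Gamma> = \<Gamma>" if \<Gamma>: "simplicial_complex n \<Gamma>" and triv: "\<Gamma> \<subseteq> {{}}" for n \<Gamma>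
  proof -
    have "\<Delta> n \<Gamma> \<subseteq> {{}}"
      using triv trivial_complex_iff_card[OF \<Gamma>] trivial_complex_iff_card[OF \<Delta>[OF \<Gamma>]] card[OF \<Gamma>]
      by simp
    then have "\<Delta> n \<Gamma> = {} \<or> \<Delta> n \<Gamma> = {{}}" and "\<Gamma> = {} \<or> \<Gamma> = {{}}"
      using triv by blast+
    then show ?thesis using card[OF \<Gamma>] by (elim disjE) simp_all
  qed
  have "simplicial_complex n \<Gamma> \<Longrightarrow> shifted n \<Gamma> \<Longrightarrow> \<Delta> n \<Gamma> = \<Gamma>" for n \<Gamma>
  proof (induction n arbitrary: \<Gamma>)
    case 0
    then show ?case by (intro trivial) (auto simp: simplicial_complex_def)
  next
    case (Suc n)
    then have \<Gamma>: "simplicial_complex (n + 1) \<Gamma>" "shifted (n + 1) \<Gamma>" by simp_all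
    note \<Delta>\<Gamma> = \<Delta>[OF \<Gamma>(1)]
    have "\<Delta> (n + 1) \<Gamma> = \<Gamma>"
    proof (cases "\<Gamma> \<subseteq> {{}}")
      case True
      then show ?thesis by (rule trivial[OF \<Gamma>(1)])
    next
      case False
      \<comment> \<open>Both complexes need a nonempty face before their Betti sums can be read as
        numbers of free faces.\<close>
      then have "\<not> \<Delta> (n + 1) \<Gamma> \<subseteq> {{}}"
        using trivial_complex_iff_card[OF \<Gamma>(1)] trivial_complex_iff_card[OF \<Delta>\<Gamma>] card[OF \<Gamma>(1)]
        by simp
      then obtain F F' where F: "F \<in> \<Gamma>" "F \<noteq> {}" and F': "F' \<in> \<Delta> (n + 1) \<Gamma>" "F' \<noteq> {}"
        using False by blast
      let ?D = "deletion (n + 1)" and ?L = "link (n + 1)"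
      note D = simplicial_complex_restrict(1)[OF \<Gamma>(1)] and L = simplicial_complex_restrict(2)[OF \<Gamma>(1)]
      have "\<Delta> (n + 1) \<Gamma> \<subseteq> \<Delta> (n + 1) (cone_complex n (?D \<Gamma>))"
        by (intro \<Delta>_mono simplicial_complex_cone D \<Gamma>(1) subset_cone_deletion)
      also have "\<dots> = cone_complex n (?D \<Gamma>)"
        using Suc.IH[OF D shifted_restrict(1)[OF \<Gamma>(2)]] \<Delta>_cone[OF D] by simp
      finally have sub_D: "?D (\<Delta> (n + 1) \<Gamma>) \<subseteq> ?D \<Gamma>"
        using deletion_link_cone(1)[OF D] by (auto simp: deletion_def)
      have "\<Delta> (n + 1) (cone_complex n (?L \<Gamma>)) \<subseteq> \<Delta> (n + 1) \<Gamma>"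
        by (intro \<Delta>_mono simplicial_complex_cone L \<Gamma>(1) cone_link_subset)
      moreover have "\<Delta> (n + 1) (cone_complex n (?L \<Gamma>)) = cone_complex n (?L \<Gamma>)"
        using Suc.IH[OF L shifted_restrict(2)[OF \<Gamma>(2)]] \<Delta>_cone[OF L] by simp
      ultimately have sub_L: "?L \<Gamma> \<subseteq> ?L (\<Delta> (n + 1) \<Gamma>)"
        using deletion_link_cone(2)[OF L] by (auto simp: link_def)
      have "card (free_faces (n + 1) \<Gamma>) \<le> card (free_faces (n + 1) (\<Delta> (n + 1) \<Gamma>))"
        using \<Delta>_betti[OF \<Gamma>(1)] sum_betti_shifted[OF \<Gamma> _ F, where 'k = 'k]
          sum_betti_shifted[OF \<Delta>\<Gamma> \<Delta>_shifted[OF \<Gamma>(1)] _ F', where 'k = 'k] by simp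
      then have "card (?D \<Gamma> - ?L \<Gamma>) \<le> card (?D (\<Delta> (n + 1) \<Gamma>) - ?L (\<Delta> (n + 1) \<Gamma>))"
        by (simp add: free_faces_eq)
      moreover have "?D (\<Delta> (n + 1) \<Gamma>) - ?L (\<Delta> (n + 1) \<Gamma>) \<subseteq> ?D \<Gamma> - ?L \<Gamma>"
        using sub_D sub_L by auto
      ultimately have eq: "?D (\<Delta> (n + 1) \<Gamma>) - ?L (\<Delta> (n + 1) \<Gamma>) = ?D \<Gamma> - ?L \<Gamma>"
        using finite_deletion[OF \<Gamma>(1)] by (intro card_seteq) auto
      have L_D: "?L \<Gamma> \<subseteq> ?D \<Gamma>" "?L (\<Delta> (n + 1) \<Gamma>) \<subseteq> ?D (\<Delta> (n + 1) \<Gamma>)"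
        using link_subset_deletion \<Gamma>(1) \<Delta>\<Gamma> by blast+
      \<comment> \<open>A face of the old deletion lies either in the old link, hence in the new
        link and deletion, or in the common difference.\<close>
      have "?D \<Gamma> = ?D (\<Delta> (n + 1) \<Gamma>)"
        using sub_D sub_L L_D(2) eq[THEN equalityD2] by (intro equalityI) auto
      \<comment> \<open>Each link is recovered from its deletion by removing the free faces, and
        both of these now agree.\<close>
      moreover have "?L \<Gamma> = ?L (\<Delta> (n + 1) \<Gamma>)"
        using eq calculation double_diff[OF L_D(1) order_refl] double_diff[OF L_D(2) order_refl] by simp
      ultimately show ?thesis
        using complex_eqI by metis
    qed
    then show ?case by simp
  qed
  then show ?thesis using assms(6,7) by blast
qed

end
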